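(* Let $b$ be a prime number, $d\ge1$, $\Omega=[0,1)^d$, let $I\subset\mathbb{N}_0^d$ be an index set of finite cardinality, let $\alpha>1/2$, let $\boldsymbol{\gamma}=(\gamma_1,\gamma_2,\ldots)\in[0,1]^{\mathbb{N}}$, and let $\eta\in(0,1)$. Then there exists a positive integer $m^*$ (depending on $d$, $\alpha$, $\boldsymbol{\gamma}$ and on the given $b$, $I$ and $\eta$) such that for every integer $m\ge m^*$ there are a modulus $p\in\mathbb{F}_b[x]$ with $\deg(p)=m$ and a generating vector $\boldsymbol{q}=(q_1,\ldots,q_d)\in(\mathbb{F}_b[x])^d$ with $\deg(q_j)<m$ for all $j$, for which the $b^m$ points $\boldsymbol{x}_0,\ldots,\boldsymbol{x}_{b^m-1}$ of the rank-1 polynomial lattice point set $P(p,\boldsymbol{q})$ satisfy $$\left|\frac1{b^m}\sum_{n=0}^{b^m-1}|f(\boldsymbol{x}_n)|^2-\int_\Omega|f(\boldsymbol{x})|^2\,d\boldsymbol{x}\right|\le\eta\int_\Omega|f(\boldsymbol{x})|^2\,d\boldsymbol{x}\qquad\text{for all }f\in\mathbb{P}^{\mathrm{wal}}_I(\Omega),$$ where $\mathbb{P}^{\mathrm{wal}}_I(\Omega)=\mathrm{span}\{\mathrm{wal}_{\boldsymbol{h}}:\boldsymbol{h}\in I\}$.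
   Context: Walsh functions in base $b$: for $h\in\mathbb{N}_0$ with $b$-adic expansion $h=h_0+h_1b+\cdots$ (finitely many nonzero digits) and $x\in[0,1)$ with $b$-adic expansion $x=x_1/b+x_2/b^2+\cdots$ (if two expansions exist, the one with infinitely many digits different from $b-1$ is used), $\mathrm{wal}_h(x)=\exp\left(\frac{2\pi i}{b}(h_0x_1+h_1x_2+\cdots)\right)$; for $\boldsymbol{h}\in\mathbb{N}_0^d$ and $\boldsymbol{x}\in\Omega$, $\mathrm{wal}_{\boldsymbol{h}}(\boldsymbol{x})=\prod_{j=1}^d\mathrm{wal}_{h_j}(x_j)$. Polynomial lattice point sets: identify $\mathbb{F}_b$ with $\{0,1,\ldots,b-1\}$ with arithmetic modulo $b$, and identify $h=\eta_0+\eta_1b+\cdots\in\mathbb{N}_0$ (its $b$-adic expansion) with the polynomial $h(x)=\eta_0+\eta_1x+\cdots\in\mathbb{F}_b[x]$. Let $\nu_m:\mathbb{F}_b((x^{-1}))\to[0,1)$ be $\nu_m\left(\sum_{i=w}^\infty a_ix^{-i}\right)=\sum_{i=\max\{1,w\}}^m a_ib^{-i}$. For $p\in\mathbb{F}_b[x]$ with $\deg(p)=m$ and $\boldsymbol{q}\in(\mathbb{F}_b[x])^d$ with $\deg(q_j)<m$, $P(p,\boldsymbol{q})$ consists of the $b^m$ points (counted with multiplicity) $\boldsymbol{x}_h=\left(\nu_m\left(\frac{h(x)q_1(x)}{p(x)}\right),\ldots,\nu_m\left(\frac{h(x)q_d(x)}{p(x)}\right)\right)$, $0\le h<b^m$,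 where quotients are expanded in $\mathbb{F}_b((x^{-1}))$. The parameters $\alpha$ and $\boldsymbol\gamma$ are those of the weighted Walsh space; they enter the statement only through the possible dependence of $m^*$. *)

theory Defs
  imports
    "HOL-Analysis.Analysis"
    "HOL-Library.Function_Algebras"
    "HOL-Computational_Algebra.Formal_Laurent_Series"
    "Berlekamp_Zassenhaus.Finite_Field"
begin

unbundle no fps_syntax

section \<open>Walsh functions\<close>

definition nat_digit :: "nat \<Rightarrow> nat \<Rightarrow> nat \<Rightarrow> nat" where
  "nat_digit b h k = h div b ^ k mod b"

text \<open>The entry with index \<open>i\<close> is the digit \<open>x\<^sub>i\<^sub>+\<^sub>1\<close>
  of \<open>x = x\<^sub>1 / b + x\<^sub>2 / b\<^sup>2 + \<dots>\<close>. For \<open>x\<close> outside \<open>[0,1)\<close> there is no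
  such expansion and the value is unspecified.\<close>

definition real_digit :: "nat \<Rightarrow> real \<Rightarrow> nat \<Rightarrow> nat" where
  "real_digit b x = (THE a. (\<forall>i. a i < b) \<and>
     (\<lambda>i. real (a i) / real b ^ Suc i) sums x \<and> infinite {i. a i \<noteq> b - 1})"

definition wal1 :: "nat \<Rightarrow> nat \<Rightarrow> real \<Rightarrow> complex" where
  "wal1 b h x = exp (2 * of_real pi * \<i> / of_nat b *
     (\<Sum>k | nat_digit b h k \<noteq> 0. of_nat (nat_digit b h k * real_digit b x k)))"

definition wal :: "nat \<Rightarrow> nat ^ 'd \<Rightarrow> real ^ 'd \<Rightarrow> complex" where
  "wal b h x = (\<Prod>j\<in>UNIV. wal1 b (h $ j) (x $ j))"

definition Omega :: "(real ^ 'd) set" where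
  "Omega = {x. \<forall>j. 0 \<le> x $ j \<and> x $ j < 1}"

interpretation cfun: vector_space "\<lambda>(c::complex) (f::'a \<Rightarrow> complex) x. c * f x"
  by unfold_locales (auto simp: fun_eq_iff algebra_simps)

text \<open>The elements are functions on the whole of \<open>real ^ 'd\<close>, but only their values on
  \<^const>\<open>Omega\<close> are meaningful.\<close>

definition walsh_polys :: "nat \<Rightarrow> (nat ^ 'd) set \<Rightarrow> (real ^ 'd \<Rightarrow> complex) set" where
  "walsh_polys b I = cfun.span (wal b ` I)"

section \<open>Polynomial lattice point sets\<close>

text \<open>The base is \<open>b = CARD('p)\<close>, and \<open>'p mod_ring\<close> is the field with \<open>b\<close> elements.\<close>

definition poly_of_nat :: "nat \<Rightarrow> 'p::prime_card mod_ring poly" where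
  "poly_of_nat h = (\<Sum>k | nat_digit CARD('p) h k \<noteq> 0.
     Polynomial.monom (of_nat (nat_digit CARD('p) h k)) k)"

text \<open>A formal Laurent series \<open>F\<close> here is a series in the variable \<open>x\<inverse>\<close>, so that
  \<open>fls_nth F i\<close> is the coefficient of \<open>x\<^sup>-\<^sup>i\<close>; hence the polynomial variable \<open>x\<close> is
  mapped to \<^const>\<open>fls_X_inv\<close>.\<close>

definition laurent_of_poly :: "'a::field poly \<Rightarrow> 'a fls" where
  "laurent_of_poly f = poly (map_poly fls_const f) fls_X_inv"

definition nu :: "nat \<Rightarrow> 'p::prime_card mod_ring fls \<Rightarrow> real" where
  "nu m F = (\<Sum>i = 1..m. of_int (to_int_mod_ring (fls_nth F (int i))) / real CARD('p) ^ i)"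

definition lattice_point ::
    "'p::prime_card mod_ring poly \<Rightarrow> 'p mod_ring poly ^ 'd \<Rightarrow> nat \<Rightarrow> real ^ 'd" where
  "lattice_point p q h =
     (\<chi> j. nu (Polynomial.degree p) (laurent_of_poly (poly_of_nat h * q $ j) / laurent_of_poly p))"

section \<open>Sanity checks of the encodings\<close>

lemma real_digit_expansion:
  fixes b :: nat and x :: real
  assumes b: "2 \<le> b" and x: "0 \<le> x" "x < 1"
  defines "a \<equiv> \<lambda>i. nat (\<lfloor>x * real b ^ Suc i\<rfloor> mod int b)"
  shows "\<forall>i. a i < b"
    and "(\<lambda>i. real (a i) / real b ^ Suc i) sums x"
    and "infinite {i. a i \<noteq> b - 1}"
proof -
  define r where "r n = x * real b ^ n - \<lfloor>x * real b ^ n\<rfloor>" for n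
  have r: "0 \<le> r n" "r n < 1" for n unfolding r_def by linarith+
  have b0: "real b > 0" using b by simp
  show ab: "\<forall>i. a i < b" unfolding a_def using b by (simp add: nat_less_iff)
  have aS: "real (a n) = real b * r n - r (Suc n)" for n
  proof -
    let ?N = "\<lfloor>x * real b ^ n\<rfloor>"
    have "x * real b ^ Suc n = real b * r n + of_int (int b * ?N)"
      by (simp add: r_def algebra_simps)
    then have fl: "\<lfloor>x * real b ^ Suc n\<rfloor> = \<lfloor>real b * r n\<rfloor> + int b * ?N"
      by (metis floor_add_int)
    have k: "0 \<le> \<lfloor>real b * r n\<rfloor>" "\<lfloor>real b * r n\<rfloor> < int b"
      using r[of n] b0 by (auto simp: floor_less_iff)
    have "\<lfloor>x * real b ^ Suc n\<rfloor> mod int b = \<lfloor>real b * r n\<rfloor>"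
      unfolding fl using k by simp
    then have "real (a n) = of_int \<lfloor>real b * r n\<rfloor>"
      unfolding a_def using k(1) by (metis of_nat_nat of_int_of_nat_eq)
    moreover have "r (Suc n) = real b * r n - of_int \<lfloor>real b * r n\<rfloor>"
      unfolding r_def[of "Suc n"] fl by (simp add: r_def algebra_simps)
    ultimately show ?thesis by simp
  qed
  have part: "(\<Sum>i<n. real (a i) / real b ^ Suc i) = x - r n / real b ^ n" for n
  proof (induction n)
    case 0
    have "\<lfloor>x\<rfloor> = 0" using x by (simp add: floor_eq_iff)
    then show ?case by (simp add: r_def)
  next
    case (Suc n)
    have "real (a n) / real b ^ Suc n = r n / real b ^ n - r (Suc n) / real b ^ Suc n"
      using b0 by (simp add: aS diff_divide_distrib)
    then show ?case using Suc by simp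
  qed
  have lim0: "(\<lambda>n. (1 / real b) ^ n) \<longlonglongrightarrow> 0"
    using b by (intro LIMSEQ_power_zero) auto
  have "(\<lambda>n. r n / real b ^ n) \<longlonglongrightarrow> 0"
    by (rule tendsto_sandwich[OF _ _ tendsto_const lim0])
      (use r b0 in \<open>auto simp: power_one_over divide_right_mono less_imp_le field_simps\<close>)
  then have "(\<lambda>n. x - r n / real b ^ n) \<longlonglongrightarrow> x - 0"
    by (intro tendsto_intros)
  then show "(\<lambda>i. real (a i) / real b ^ Suc i) sums x"
    unfolding sums_def part by simp
  show "infinite {i. a i \<noteq> b - 1}"
  proof
    assume "finite {i. a i \<noteq> b - 1}"
    then obtain n where n: "\<And>i. i \<ge> n \<Longrightarrow> a i = b - 1"
      by (metis (mono_tags, lifting) finite_nat_set_iff_bounded mem_Collect_eq not_le)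
    have g: "1 - r (n + k) = real b ^ k * (1 - r n)" for k
    proof (induction k)
      case (Suc k)
      have "real (a (n + k)) = real b - 1" using n[of "n + k"] b by simp
      then have "1 - r (n + Suc k) = real b * (1 - r (n + k))"
        using aS[of "n + k"] by (simp add: algebra_simps)
      then show ?case by (simp add: Suc)
    qed simp
    obtain k where "1 / (1 - r n) < real b ^ k"
      using real_arch_pow[of "real b"] b by auto
    then have "1 < real b ^ k * (1 - r n)"
      using r[of n] by (simp add: field_simps)
    then show False using g[of k] r(1)[of "n + k"] by linarith
  qed
qed

lemma real_digit_unique:
  fixes b :: nat and x :: real
  assumes b: "2 \<le> b" and ab: "\<forall>i. a i < b"
    and s: "(\<lambda>i. real (a i) / real b ^ Suc i) sums x"
    and inf: "infinite {i. a i \<noteq> b - 1}"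
  shows "a i = nat (\<lfloor>x * real b ^ Suc i\<rfloor> mod int b)"
proof -
  define P where "P n = (\<Sum>i<n. real (a i) / real b ^ Suc i)" for n
  define T where "T n = real b ^ n * (x - P n)" for n
  have b0: "real b > 0" using b by simp
  have PS: "P (Suc n) = P n + real (a n) / real b ^ Suc n" for n by (simp add: P_def)
  have TS: "T (Suc n) = real b * T n - real (a n)" for n
    using b0 by (simp add: T_def PS field_simps)
  have lim: "P \<longlonglongrightarrow> x" using s unfolding sums_def P_def .
  have ale: "real (a n) \<le> real b - 1" for n
    using ab[rule_format, of n] by linarith
  have up: "P (n + k) \<le> P n + 1 / real b ^ n - 1 / real b ^ (n + k)" for n k
  proof (induction k)
    case (Suc k)
    have "real (a (n + k)) / real b ^ Suc (n + k) \<le> (real b - 1) / real b ^ Suc (n + k)"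
      using ale b0 by (intro divide_right_mono) auto
    also have "\<dots> = 1 / real b ^ (n + k) - 1 / real b ^ (n + Suc k)"
      using b0 by (simp add: field_simps)
    finally show ?case using Suc PS[of "n + k"] by simp
  qed simp
  have "x \<le> P n + 1 / real b ^ n" for n
  proof (rule LIMSEQ_le_const2[OF lim], intro exI[of _ n] allI impI)
    fix l assume "n \<le> l"
    then obtain k where "l = n + k" by (auto simp: le_iff_add)
    moreover have "0 \<le> 1 / real b ^ (n + k)" using b0 by simp
    ultimately show "P l \<le> P n + 1 / real b ^ n" using up[of n k] by (simp only:)
  qed
  then have T1: "T n \<le> 1" for n
    using b0 by (simp add: T_def field_simps)
  have mono: "P n \<le> P (n + k)" for n k
    by (induction k) (auto simp: PS intro: order_trans)
  have "P n \<le> x" for n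
    by (rule LIMSEQ_le_const[OF lim]) (metis mono le_iff_add)
  then have T0: "0 \<le> T n" for n using b0 by (simp add: T_def)
  have T1': "T n < 1" for n
  proof (rule ccontr)
    assume "\<not> T n < 1"
    then have Tn: "T n = 1" using T1[of n] by linarith
    have Tk: "T (n + k) = 1" for k
    proof (induction k)
      case (Suc k)
      then show ?case using TS[of "n + k"] T1[of "n + Suc k"] ale[of "n + k"] by simp
    qed (simp add: Tn)
    have "a (n + k) = b - 1" for k
      using TS[of "n + k"] Tk[of k] Tk[of "Suc k"] by simp
    then have "{i. a i \<noteq> b - 1} \<subseteq> {..<n}"
      by (auto simp: not_le[symmetric] le_iff_add)
    then show False using inf finite_subset by blast
  qed
  have key: "\<exists>N::int. x * real b ^ n = N + T n" for n
  proof (induction n)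
    case 0
    show ?case by (rule exI[of _ 0]) (simp add: T_def P_def)
  next
    case (Suc n)
    then obtain N :: int where N: "x * real b ^ n = N + T n" ..
    have "x * real b ^ Suc n = real b * (x * real b ^ n)" by simp
    then have "x * real b ^ Suc n = of_int (int b * N + int (a n)) + T (Suc n)"
      unfolding N TS by (simp add: algebra_simps)
    then show ?case by blast
  qed
  obtain N :: int where N: "x * real b ^ i = N + T i" using key by blast
  have "x * real b ^ Suc i = real b * (x * real b ^ i)" by simp
  then have "x * real b ^ Suc i = of_int (int b * N + int (a i)) + T (Suc i)"
    unfolding N TS by (simp add: algebra_simps)
  then have "\<lfloor>x * real b ^ Suc i\<rfloor> = int b * N + int (a i)"
    using T0[of "Suc i"] T1'[of "Suc i"] by (intro floor_unique) linarith+
  then show ?thesis using ab[rule_format, of i] by simp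
qed

lemma real_digit_eq:
  assumes "2 \<le> b" and "0 \<le> x" and "x < 1"
  shows "real_digit b x i = nat (\<lfloor>x * real b ^ Suc i\<rfloor> mod int b)"
proof -
  have "real_digit b x = (\<lambda>i. nat (\<lfloor>x * real b ^ Suc i\<rfloor> mod int b))"
    unfolding real_digit_def
    by (rule the_equality)
      (use real_digit_expansion[OF assms] real_digit_unique[OF assms(1)] in blast)+
  then show ?thesis by simp
qed

lemma finite_nat_digit:
  assumes "2 \<le> b"
  shows "finite {k. nat_digit b h k \<noteq> 0}"
proof (rule finite_subset)
  show "{k. nat_digit b h k \<noteq> 0} \<subseteq> {..<h}"
  proof (intro subsetI, rule ccontr)
    fix k assume k: "k \<in> {k. nat_digit b h k \<noteq> 0}" "k \<notin> {..<h}"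
    have "k < b ^ k" using assms by (simp add: power_gt_expt)
    then show False using k by (auto simp: nat_digit_def)
  qed
qed simp

lemma laurent_of_poly_nth:
  "fls_nth (laurent_of_poly f) i = (if i \<le> 0 then Polynomial.coeff f (nat (- i)) else 0)"
proof (induction f arbitrary: i)
  case 0
  show ?case by (simp add: laurent_of_poly_def)
next
  case (pCons c f)
  have "laurent_of_poly (pCons c f) = fls_const c + fls_X_inv * laurent_of_poly f"
    using pCons by (simp add: laurent_of_poly_def map_poly_pCons)
  moreover have "nat (- i) = Suc (nat (- (i + 1)))" if "i < 0" using that by simp
  ultimately show ?case
    by (auto simp: fls_X_inv_times_conv_shift pCons.IH coeff_pCons split: nat.splits)
qed

end

theory Submission
  imports Defs
begin

text \<open>Choose \<open>s\<close> such that all entries of the indices in \<open>I\<close> have at most \<open>s\<close> digits. Then every Walsh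
  polynomial over \<open>I\<close> is constant on the half-open cubes of side \<open>b\<^sup>-\<^sup>s\<close>. For the modulus \<open>x\<^sup>m\<close> and
  monomials \<open>q\<^sub>j\<close> whose degrees are distinct multiples of \<open>s\<close>, the first \<open>s\<close> digits of the
  coordinates of the \<open>n\<close>-th point are disjoint blocks of digits of \<open>n\<close>. If \<open>m \<ge> s d\<close>, every cube
  therefore contains exactly \<open>b\<^sup>m\<^sup>-\<^sup>s\<^sup>d\<close> of the points, and the quadrature of \<open>|f|\<^sup>2\<close> is exact.\<close>

section \<open>Walsh polynomials are constant on the cubes of a fine enough grid\<close>

definition cell :: "nat \<Rightarrow> real ^ 'd \<Rightarrow> 'd \<Rightarrow> nat" where
  "cell B x j = nat \<lfloor>real B * x $ j\<rfloor>"

definition corner :: "nat \<Rightarrow> ('d \<Rightarrow> nat) \<Rightarrow> real ^ 'd" where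
  "corner B c = (\<chi> j. real (c j) / real B)"

text \<open>Digit \<open>k\<close> depends only on the floor of \<open>x * b ^ Suc k\<close>. For
  \<open>k < s\<close> this is the floor of \<open>b ^ s * x\<close> divided by the integer
  \<open>b ^ (s - Suc k)\<close>, and taking the floor before such a division does not change the
  floor of the quotient.\<close>

lemma real_digit_truncate:
  assumes b: "2 \<le> b" and x: "0 \<le> x" "x < 1" and k: "k < s"
  shows "real_digit b (real (nat \<lfloor>real (b ^ s) * x\<rfloor>) / real (b ^ s)) k = real_digit b x k"
proof -
  define y where "y = real (b ^ s) * x"
  have b0: "real b > 0" using b by simp
  have y: "0 \<le> y" "y < real (b ^ s)" using x b0 by (auto simp: y_def)
  have N: "real (nat \<lfloor>y\<rfloor>) = of_int \<lfloor>y\<rfloor>" using y by simp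
  have lt: "of_int \<lfloor>y\<rfloor> < real (b ^ s)" using y by linarith
  have pow: "b ^ s = b ^ Suc k * b ^ (s - Suc k)"
    using k power_add[of b "Suc k" "s - Suc k"] by (simp del: power_Suc)
  have scale: "z / real (b ^ s) * real b ^ Suc k = z / of_int (int (b ^ (s - Suc k)))" for z
    using b0 by (simp add: pow field_simps)
  have "real_digit b (real (nat \<lfloor>y\<rfloor>) / real (b ^ s)) k
      = nat (\<lfloor>of_int \<lfloor>y\<rfloor> / real (b ^ s) * real b ^ Suc k\<rfloor> mod int b)"
    unfolding N by (rule real_digit_eq) (use b y lt in auto)
  also have "\<lfloor>of_int \<lfloor>y\<rfloor> / real (b ^ s) * real b ^ Suc k\<rfloor> = \<lfloor>y / real (b ^ s) * real b ^ Suc k\<rfloor>"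
    unfolding scale by (simp only: floor_divide_real_eq_div floor_of_int of_nat_0_le_iff)
  also have "y / real (b ^ s) = x" using b0 by (simp add: y_def)
  also have "nat (\<lfloor>x * real b ^ Suc k\<rfloor> mod int b) = real_digit b x k"
    using real_digit_eq[OF b x] by simp
  finally show ?thesis by (simp add: y_def)
qed

text \<open>An index below \<open>b ^ s\<close> has no nonzero digit at position \<open>s\<close> or
  later, so only the first \<open>s\<close> digits of \<open>x\<close> enter the exponent, and these
  survive truncation.\<close>

lemma wal1_truncate:
  assumes b: "2 \<le> b" and x: "0 \<le> x" "x < 1" and h: "h < b ^ s"
  shows "wal1 b h (real (nat \<lfloor>real (b ^ s) * x\<rfloor>) / real (b ^ s)) = wal1 b h x"
proof -
  have lt: "k < s" if "nat_digit b h k \<noteq> 0" for k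
  proof (rule ccontr)
    assume "\<not> k < s"
    then have "b ^ s \<le> b ^ k" using b by (intro power_increasing) auto
    then show False using that h by (simp add: nat_digit_def)
  qed
  have "(\<Sum>k | nat_digit b h k \<noteq> 0. of_nat (nat_digit b h k *
        real_digit b (real (nat \<lfloor>real (b ^ s) * x\<rfloor>) / real (b ^ s)) k))
      = (\<Sum>k | nat_digit b h k \<noteq> 0. of_nat (nat_digit b h k * real_digit b x k) :: complex)"
    by (intro sum.cong refl) (subst real_digit_truncate[OF b x lt]; simp)
  then show ?thesis by (simp only: wal1_def)
qed

text \<open>For a fixed point, taking equal values there and at the corner of its cell is a linear
  condition on \<open>f\<close>, so it suffices to check the spanning Walsh functions, coordinate by
  coordinate.\<close>

lemma walsh_polys_const_on_cells:
  fixes I :: "(nat ^ 'd) set"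
  assumes b: "2 \<le> b" and f: "f \<in> walsh_polys b I" and I: "\<forall>h\<in>I. \<forall>j. h $ j < b ^ s"
    and x: "x \<in> Omega"
  shows "f (corner (b ^ s) (cell (b ^ s) x)) = f x"
  using f unfolding walsh_polys_def
proof (rule cfun.span_induct)
  show "cfun.subspace {f. f (corner (b ^ s) (cell (b ^ s) x)) = f x}"
    by (simp add: cfun.subspace_def)
next
  fix g assume "g \<in> wal b ` I"
  then obtain h where h: "h \<in> I" "g = wal b h" by blast
  show "g (corner (b ^ s) (cell (b ^ s) x)) = g x"
    unfolding h(2) wal_def corner_def cell_def vec_lambda_beta
    by (rule prod.cong[OF refl], rule wal1_truncate) (use b x I h(1) in \<open>auto simp: Omega_def\<close>)
qed

section \<open>Integrals of functions that are constant on the cells\<close>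

text \<open>The half-open box lies between the open and the closed box, which have the same
  volume.\<close>

lemma half_open_box_lborel:
  fixes l u :: "real ^ 'd"
  assumes le: "\<And>j. l $ j \<le> u $ j"
  defines "H \<equiv> {x. \<forall>j. l $ j \<le> x $ j \<and> x $ j < u $ j}"
  shows "H \<in> sets lborel" and "emeasure lborel H < \<infinity>"
    and "measure lborel H = (\<Prod>j\<in>UNIV. u $ j - l $ j)"
proof -
  have H: "H = (\<Inter>j. {x. l $ j \<le> x $ j} \<inter> {x. x $ j < u $ j})" by (auto simp: H_def)
  have "{x. l $ j \<le> x $ j} \<inter> {x. x $ j < u $ j} \<in> sets borel" for j
    by (intro sets.Int borel_closed borel_open closed_Collect_le open_Collect_less continuous_intros)
  then show sets: "H \<in> sets lborel" unfolding H sets_lborel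
    by (intro sets.countable_INT'') (auto simp: countable_finite)
  have sub: "box l u \<subseteq> H" "H \<subseteq> cbox l u"
    by (auto simp: H_def mem_box_cart less_imp_le)
  show fin: "emeasure lborel H < \<infinity>"
    by (rule le_less_trans[OF emeasure_mono[OF sub(2)] emeasure_lborel_cbox_finite]) simp
  have "\<forall>i\<in>Basis. l \<bullet> i \<le> u \<bullet> i"
    using le by (auto simp: Basis_vec_def inner_axis)
  then have "measure lborel (box l u) = measure lborel (cbox l u)"
    by (simp add: measure_lborel_box_eq measure_lborel_cbox_eq)
  moreover have "measure lborel (box l u) \<le> measure lborel H"
    by (rule measure_mono_fmeasurable) (use sub sets fin in \<open>auto simp: fmeasurable_def\<close>)
  moreover have "measure lborel H \<le> measure lborel (cbox l u)"
    by (rule measure_mono_fmeasurable) (use sub sets fmeasurable_cbox in auto)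
  ultimately have "measure lborel H = measure lborel (cbox l u)" by linarith
  also have "\<dots> = (\<Prod>j\<in>UNIV. u $ j - l $ j)"
    using le by (subst content_cbox_cart) (auto simp: interval_ne_empty_cart)
  finally show "measure lborel H = (\<Prod>j\<in>UNIV. u $ j - l $ j)" .
qed

lemma cell_eq_iff:
  fixes x :: "real ^ 'd"
  assumes B: "B > 0"
  shows "x \<in> Omega \<and> cell B x = c \<longleftrightarrow>
    (\<forall>j. c j < B) \<and> (\<forall>j. real (c j) / real B \<le> x $ j \<and> x $ j < (real (c j) + 1) / real B)"
proof -
  \<comment> \<open>Nonnegativity matters here: \<open>nat\<close> sends negative floors to 0, so a
    negative \<open>t\<close> would wrongly be assigned to the interval with index 0.\<close>
  have eq: "nat \<lfloor>real B * t\<rfloor> = n \<longleftrightarrow> real n / real B \<le> t \<and> t < (real n + 1) / real B"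
    if "0 \<le> t" for t n
  proof -
    have "nat \<lfloor>real B * t\<rfloor> = n \<longleftrightarrow> \<lfloor>real B * t\<rfloor> = int n" using that by auto
    also have "\<dots> \<longleftrightarrow> real n \<le> real B * t \<and> real B * t < real n + 1"
      by (simp add: floor_eq_iff)
    finally show ?thesis using B by (simp add: field_simps)
  qed
  have pos: "0 \<le> t" if "real n / real B \<le> t" for t n
    using that by (rule order_trans[rotated]) simp
  have lt: "n < B" if "real n / real B \<le> t" "t < 1" for t n
  proof -
    have "real n / real B < 1" using that by linarith
    then show ?thesis using B by simp
  qed
  have lt1: "t < 1" if "n < B" "t < (real n + 1) / real B" for t n
  proof -
    have "(real n + 1) / real B \<le> 1" using that(1) by simp
    then show ?thesis using that(2) by linarith
  qed
  show ?thesis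
    unfolding Omega_def cell_def fun_eq_iff mem_Collect_eq
    using eq pos lt lt1 by metis
qed

text \<open>On \<open>Omega\<close> the function is a step function over \<open>B ^ CARD('d)\<close>
  cells of equal volume, so its integral is the plain average of the corner values.\<close>

lemma integral_const_on_cells:
  fixes F :: "real ^ 'd \<Rightarrow> real"
  assumes B: "B > 0" and F: "\<And>x. x \<in> Omega \<Longrightarrow> F (corner B (cell B x)) = F x"
  shows "(LINT x:Omega|lborel. F x)
    = (\<Sum>c \<in> PiE UNIV (\<lambda>_. {..<B}). F (corner B c)) / real (B ^ CARD('d))"
proof -
  let ?C = "PiE UNIV (\<lambda>_::'d. {..<B})"
  define Q where "Q c = {x \<in> Omega. cell B x = c}" for c :: "'d \<Rightarrow> nat"
  have fin: "finite ?C" by (intro finite_PiE) auto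
  have Q: "Q c \<in> sets lborel" "emeasure lborel (Q c) < \<infinity>"
      "measure lborel (Q c) = 1 / real (B ^ CARD('d))" if c: "c \<in> ?C" for c
  proof -
    have Qc: "Q c = {x::real ^ 'd. \<forall>j. corner B c $ j \<le> x $ j \<and> x $ j < (\<chi> j. (real (c j) + 1) / real B) $ j}"
      using c cell_eq_iff[OF B, of _ c] by (auto simp: Q_def corner_def PiE_iff)
    have le: "corner B c $ j \<le> (\<chi> j. (real (c j) + 1) / real B) $ j" for j
      by (simp add: corner_def divide_right_mono)
    show "Q c \<in> sets lborel" "emeasure lborel (Q c) < \<infinity>"
      unfolding Qc by (rule half_open_box_lborel; rule le)+
    have "measure lborel (Q c) = (\<Prod>j\<in>(UNIV::'d set). 1 / real B)"
      unfolding Qc by (subst half_open_box_lborel(3)[OF le])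
        (simp add: corner_def flip: diff_divide_distrib)
    then show "measure lborel (Q c) = 1 / real (B ^ CARD('d))" by (simp add: power_one_over)
  qed
  \<comment> \<open>Inside \<open>Omega\<close> only the cell containing \<open>x\<close>
    contributes; outside, both sides vanish because every \<open>Q c\<close> is a subset of
    \<open>Omega\<close>.\<close>
  have split: "indicator Omega x *\<^sub>R F x = (\<Sum>c\<in>?C. indicator (Q c) x *\<^sub>R F (corner B c))" for x
  proof (cases "x \<in> Omega")
    case True
    then have "cell B x \<in> ?C" using cell_eq_iff[OF B, of x "cell B x"] by (auto simp: PiE_iff)
    moreover have "indicator (Q c) x *\<^sub>R F (corner B c) = (if cell B x = c then F x else 0)" for c
      using True F by (auto simp: Q_def)
    ultimately show ?thesis using True fin by simp
  qed (simp add: Q_def)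
  have "(LINT x:Omega|lborel. F x)
      = (LINT x|lborel. (\<Sum>c\<in>?C. indicator (Q c) x *\<^sub>R F (corner B c)))"
    unfolding set_lebesgue_integral_def split ..
  also have "\<dots> = (\<Sum>c\<in>?C. LINT x|lborel. indicator (Q c) x *\<^sub>R F (corner B c))"
    using Q by (intro Bochner_Integration.integral_sum integrable_scaleR_left
      integrable_real_indicator) auto
  also have "\<dots> = (\<Sum>c\<in>?C. F (corner B c) / real (B ^ CARD('d)))"
    using Q by (intro sum.cong) auto
  finally show ?thesis by (simp add: sum_divide_distrib)
qed

section \<open>Digit vectors and sums over blocks of consecutive integers\<close>

lemma sum_nat_digit: "(\<Sum>l<k. nat_digit b n l * b ^ l) = n mod b ^ k"
proof (induction k)
  case (Suc k)
  have "n mod b ^ Suc k = b ^ k * (n div b ^ k mod b) + n mod b ^ k"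
    by (metis mod_mult2_eq power_Suc2)
  then show ?case using Suc by (simp add: nat_digit_def mult.commute)
qed simp

lemma digits_inject:
  fixes B :: nat
  assumes "\<And>i. i < d \<Longrightarrow> nat_digit B m i = nat_digit B n i" and "m < B ^ d" and "n < B ^ d"
  shows "m = n"
proof -
  have "m mod B ^ d = n mod B ^ d"
    unfolding sum_nat_digit[symmetric] using assms(1) by simp
  then show ?thesis using assms(2,3) by simp
qed

text \<open>Digits determine a number below \<open>B ^ CARD('d)\<close>, which gives injectivity;
  surjectivity follows by counting. The enumeration \<open>idx\<close> assigns digit positions to
  the coordinates, since \<open>'d\<close> carries no order.\<close>

lemma bij_betw_digits:
  fixes idx :: "'d::finite \<Rightarrow> nat"
  assumes idx: "bij_betw idx UNIV {..<CARD('d)}" and B: "B > 0"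
  shows "bij_betw (\<lambda>n j. nat_digit B n (idx j)) {..<B ^ CARD('d)} (PiE UNIV (\<lambda>_. {..<B}))"
proof -
  let ?D = "\<lambda>n j. nat_digit B n (idx j)"
  have inj: "inj_on ?D {..<B ^ CARD('d)}"
  proof (rule inj_onI)
    fix m n assume mn: "m \<in> {..<B ^ CARD('d)}" "n \<in> {..<B ^ CARD('d)}" and eq: "?D m = ?D n"
    have "nat_digit B m i = nat_digit B n i" if "i < CARD('d)" for i
    proof -
      have "i \<in> range idx" using that bij_betw_imp_surj_on[OF idx] by simp
      then show ?thesis using fun_cong[OF eq] by auto
    qed
    then show "m = n" by (rule digits_inject) (use mn in auto)
  qed
  have sub: "?D ` {..<B ^ CARD('d)} \<subseteq> PiE UNIV (\<lambda>_. {..<B})"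
    using B by (auto simp: nat_digit_def)
  have "card (?D ` {..<B ^ CARD('d)}) = card (PiE UNIV (\<lambda>_::'d. {..<B}))"
    using inj by (simp add: card_image card_PiE)
  then have "?D ` {..<B ^ CARD('d)} = PiE UNIV (\<lambda>_. {..<B})"
    using sub by (intro card_subset_eq finite_PiE) auto
  with inj show ?thesis by (simp add: bij_betw_def)
qed

text \<open>The range splits into \<open>k\<close> blocks of length \<open>a\<close> on which
  \<open>n div a\<close> is constant. This is used to discard the low digits of \<open>n\<close>
  that do not influence the cell.\<close>

lemma sum_div_lessThan:
  fixes g :: "nat \<Rightarrow> real"
  shows "(\<Sum>n<k * a. g (n div a)) = real a * (\<Sum>i<k. g i)"
proof -
  have "(\<Sum>n<k * a. g (n div a)) = (\<Sum>i<k. \<Sum>n\<in>{i * a..<i * a + a}. g (n div a))"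
    by (rule sum.nat_group[symmetric])
  also have "\<dots> = (\<Sum>i<k. \<Sum>n\<in>{i * a..<i * a + a}. g i)"
    by (intro sum.cong refl arg_cong[of _ _ g]) (auto intro!: div_nat_eqI simp: algebra_simps)
  finally show ?thesis by (simp add: sum_distrib_left)
qed

section \<open>Lattice points for the modulus x^m and monomial generators\<close>

lemma coeff_poly_of_nat:
  "Polynomial.coeff (poly_of_nat n :: 'p::prime_card mod_ring poly) k
    = of_nat (nat_digit CARD('p) n k)"
proof -
  have "2 \<le> CARD('p)" using prime_card prime_ge_2_nat by blast
  from finite_nat_digit[OF this] show ?thesis
    by (simp add: poly_of_nat_def coeff_sum)
qed

lemma to_int_mod_ring_of_nat:
  assumes "a < CARD('p)"
  shows "to_int_mod_ring (of_nat a :: 'p::prime_card mod_ring) = int a"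
  using assms by (simp add: of_nat_of_int_mod_ring)

text \<open>The series variable is the inverse of x, so x^m becomes \<open>fls_X_inv ^ m\<close>,
  and dividing by it merely shifts the coefficients by \<open>m\<close> places.\<close>

lemma laurent_of_poly_divide_monom_nth:
  "fls_nth (laurent_of_poly f / laurent_of_poly (Polynomial.monom 1 m)) i
    = (if i \<le> int m then Polynomial.coeff f (nat (int m - i)) else 0)"
proof -
  have X: "laurent_of_poly (Polynomial.monom 1 m) = (fls_X_inv ^ m :: 'a::field fls)"
    by (rule fls_eqI) (auto simp: laurent_of_poly_nth fls_X_inv_power_conv_shift_1 algebra_simps)
  show ?thesis
    unfolding X by (simp add: laurent_of_poly_nth)
qed

text \<open>With \<open>k = m - e\<close>, the coefficient of x^(-i) in the quotient is digit
  \<open>k - i\<close> of \<open>n\<close>. The lowest \<open>k\<close> digits of \<open>n\<close>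
  thus move behind the radix point in their usual order, giving the fractional part of n /
  b^k.\<close>

lemma nu_monom_quotient:
  assumes e: "e \<le> m"
  shows "nu m (laurent_of_poly ((poly_of_nat n :: 'p::prime_card mod_ring poly) * Polynomial.monom 1 e)
      / laurent_of_poly (Polynomial.monom 1 m))
    = real (n mod CARD('p) ^ (m - e)) / real (CARD('p) ^ (m - e))"
proof -
  define b where "b = CARD('p)"
  define k where "k = m - e"
  have b0: "b > 0" by (simp add: b_def)
  have c: "to_int_mod_ring (fls_nth (laurent_of_poly ((poly_of_nat n :: 'p mod_ring poly)
        * Polynomial.monom 1 e) / laurent_of_poly (Polynomial.monom 1 m)) (int i))
      = (if i \<le> k then int (nat_digit b n (k - i)) else 0)" for i
  proof -
    have "to_int_mod_ring (of_nat (nat_digit b n l) :: 'p mod_ring) = int (nat_digit b n l)" for l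
      using b0 by (intro to_int_mod_ring_of_nat) (simp add: nat_digit_def b_def)
    moreover have "m - i - e = k - i" by (simp add: k_def)
    moreover have "nat (int m - int i) = m - i" by simp
    ultimately show ?thesis
      using e by (auto simp: laurent_of_poly_divide_monom_nth mult.commute[of "poly_of_nat n"]
        coeff_monom_mult coeff_poly_of_nat k_def b_def)
  qed
  have "nu m (laurent_of_poly ((poly_of_nat n :: 'p mod_ring poly) * Polynomial.monom 1 e)
      / laurent_of_poly (Polynomial.monom 1 m))
    = (\<Sum>i = 1..m. (if i \<le> k then real (nat_digit b n (k - i)) / real b ^ i else 0))"
    unfolding nu_def c b_def[symmetric] by (intro sum.cong) auto
  also have "\<dots> = (\<Sum>i = 1..k. real (nat_digit b n (k - i)) / real b ^ i)"
    by (rule sum.mono_neutral_cong_right) (auto simp: k_def)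
  also have "\<dots> = (\<Sum>l<k. real (nat_digit b n l * b ^ l) / real (b ^ k))"
  proof (rule sum.reindex_bij_witness[of _ "\<lambda>l. k - l" "\<lambda>i. k - i"])
    fix i assume i: "i \<in> {1..k}"
    then have "real b ^ k = real b ^ (k - i) * real b ^ i" by (simp flip: power_add)
    then show "real (nat_digit b n (k - i) * b ^ (k - i)) / real (b ^ k)
        = real (nat_digit b n (k - i)) / real b ^ i"
      using b0 by simp
  qed auto
  also have "\<dots> = real (n mod b ^ k) / real (b ^ k)"
    by (simp only: sum_nat_digit[symmetric] of_nat_sum sum_divide_distrib)
  finally show ?thesis by (simp add: b_def k_def)
qed

text \<open>Scaling by \<open>b ^ s\<close> leaves a division by \<open>b ^ t\<close>, so the floor
  reads off the block of digits \<open>t\<close>, ..., \<open>t + s - 1\<close> of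
  \<open>n\<close>.\<close>

lemma nat_floor_scaled_fraction:
  fixes b :: nat
  assumes b: "b > 0"
  shows "nat \<lfloor>real (b ^ s) * (real (n mod b ^ (t + s)) / real (b ^ (t + s)))\<rfloor> = n div b ^ t mod b ^ s"
proof -
  have "real (b ^ s) * (real (n mod b ^ (t + s)) / real (b ^ (t + s)))
      = real (n mod b ^ (t + s)) / real (b ^ t)"
    using b by (simp add: power_add)
  then have "nat \<lfloor>real (b ^ s) * (real (n mod b ^ (t + s)) / real (b ^ (t + s)))\<rfloor>
      = (n mod b ^ (t + s)) div b ^ t"
    by (simp only: floor_divide_of_nat_eq nat_int)
  also have "\<dots> = n div b ^ t mod b ^ s"
    using b by (simp add: power_add mod_mult2_eq)
  finally show ?thesis .
qed

text \<open>The exponents are chosen so that the first \<open>s\<close> digits of coordinate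
  \<open>j\<close> are the block of \<open>n\<close> starting at position
  \<open>(m - s * CARD('d)) + s * idx j\<close>. Different coordinates get adjacent disjoint blocks,
  which together are the top \<open>s * CARD('d)\<close> of the \<open>m\<close> digits of
  \<open>n\<close>.\<close>

lemma lattice_point_monom_cell:
  fixes idx :: "'d::finite \<Rightarrow> nat" and x :: "real ^ 'd" and n :: nat
  assumes idx: "idx j < CARD('d)" and m: "s * CARD('d) \<le> m"
  defines "x \<equiv> lattice_point (Polynomial.monom 1 m :: 'p::prime_card mod_ring poly)
    (\<chi> j. Polynomial.monom 1 (s * (CARD('d) - 1 - idx j))) n"
  shows "cell (CARD('p) ^ s) x j
      = nat_digit (CARD('p) ^ s) (n div CARD('p) ^ (m - s * CARD('d))) (idx j)"
    and "0 \<le> x $ j" and "x $ j < 1"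
proof -
  define e where "e = s * (CARD('d) - 1 - idx j)"
  define t where "t = (m - s * CARD('d)) + s * idx j"
  \<comment> \<open>The bound on \<open>idx j\<close> makes the truncated subtraction exact.\<close>
  have "CARD('d) = (CARD('d) - 1 - idx j) + idx j + 1" using idx by simp
  then have "s * CARD('d) = e + s * idx j + s" unfolding e_def by (metis add_mult_distrib2 mult.right_neutral)
  then have e: "e \<le> m" "m - e = t + s" using m by (auto simp: t_def)
  have x: "x $ j = real (n mod CARD('p) ^ (t + s)) / real (CARD('p) ^ (t + s))"
    using nu_monom_quotient[OF e(1), where ?'p = 'p, of n]
    unfolding e(2) by (simp add: x_def lattice_point_def degree_monom_eq e_def)
  show "0 \<le> x $ j" "x $ j < 1" unfolding x by (simp_all add: divide_less_eq_1)
  show "cell (CARD('p) ^ s) x j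
      = nat_digit (CARD('p) ^ s) (n div CARD('p) ^ (m - s * CARD('d))) (idx j)"
    unfolding cell_def x nat_digit_def
    by (subst nat_floor_scaled_fraction) (simp_all add: t_def power_add power_mult div_mult2_eq)
qed

text \<open>As \<open>n\<close> runs below \<open>b ^ m\<close>, \<open>n div b ^ M\<close> takes
  each value below \<open>B ^ CARD('d)\<close> exactly \<open>b ^ M\<close> times, and the digits of
  these values list every cell once. So the lattice average is the average over corners, which is
  the integral.\<close>

lemma lattice_sum_const_on_cells:
  fixes F :: "real ^ 'd \<Rightarrow> real" and idx :: "'d \<Rightarrow> nat"
  defines "b \<equiv> CARD('p::prime_card)"
  assumes F: "\<And>x. x \<in> Omega \<Longrightarrow> F (corner (b ^ s) (cell (b ^ s) x)) = F x"
    and idx: "bij_betw idx UNIV {..<CARD('d)}" and m: "s * CARD('d) \<le> m"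
  shows "(\<Sum>n<b ^ m. F (lattice_point (Polynomial.monom 1 m :: 'p mod_ring poly)
      (\<chi> j. Polynomial.monom 1 (s * (CARD('d) - 1 - idx j))) n)) / real (b ^ m)
    = (LINT x:Omega|lborel. F x)"
proof -
  define B where "B = b ^ s"
  define M where "M = m - s * CARD('d)"
  define X where "X = lattice_point (Polynomial.monom 1 m :: 'p mod_ring poly)
      (\<chi> j. Polynomial.monom 1 (s * (CARD('d) - 1 - idx j)))"
  define D where "D n j = nat_digit B n (idx j)" for n j
  have B0: "B > 0" by (simp add: B_def b_def)
  have lt: "idx j < CARD('d)" for j using bij_betwE[OF idx] by simp
  have bm: "b ^ m = B ^ CARD('d) * b ^ M"
    using m by (simp add: B_def M_def flip: power_mult power_add)
  have "F (X n) = F (corner B (D (n div b ^ M)))" for n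
  proof -
    have "X n \<in> Omega"
      using lattice_point_monom_cell(2,3)[where ?'p = 'p and n = n and idx = idx, OF lt m] by (simp add: Omega_def X_def)
    moreover have "cell B (X n) = D (n div b ^ M)"
      unfolding D_def X_def B_def M_def b_def
      by (rule ext, rule lattice_point_monom_cell(1)[where idx = idx, OF lt m])
    ultimately show ?thesis using F[of "X n"] by (simp add: B_def)
  qed
  then have "(\<Sum>n<b ^ m. F (X n)) = (\<Sum>n<B ^ CARD('d) * b ^ M. F (corner B (D (n div b ^ M))))"
    by (simp add: bm)
  also have "\<dots> = real (b ^ M) * (\<Sum>n<B ^ CARD('d). F (corner B (D n)))"
    by (rule sum_div_lessThan)
  also have "(\<Sum>n<B ^ CARD('d). F (corner B (D n))) = (\<Sum>c \<in> PiE UNIV (\<lambda>_. {..<B}). F (corner B c))"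
    using bij_betw_digits[OF idx B0]
    by (intro sum.reindex_bij_betw[of D "{..<B ^ CARD('d)}"]) (simp add: D_def[abs_def])
  finally have "(\<Sum>n<b ^ m. F (X n)) / real (b ^ m)
      = (\<Sum>c \<in> PiE UNIV (\<lambda>_. {..<B}). F (corner B c)) / real (B ^ CARD('d))"
    unfolding bm by (simp add: b_def)
  also have "\<dots> = (LINT x:Omega|lborel. F x)"
    using F by (intro integral_const_on_cells[symmetric] B0) (simp add: B_def)
  finally show ?thesis by (simp add: X_def)
qed

theorem theorem3p8:
  fixes b :: nat
    and I :: "(nat ^ 'd) set"
    and \<alpha> \<eta> :: real
    and \<gamma> :: "nat \<Rightarrow> real"
  assumes "b = CARD('p::prime_card)"
    and "finite I"
    and "\<alpha> > 1 / 2"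
    and "\<forall>j\<ge>1. 0 \<le> \<gamma> j \<and> \<gamma> j \<le> 1"
    and "0 < \<eta>" and "\<eta> < 1"
  shows "\<exists>m0::nat. m0 > 0 \<and> (\<forall>m\<ge>m0.
    \<exists>(p :: 'p::prime_card mod_ring poly) (q :: 'p mod_ring poly ^ 'd).
      Polynomial.degree p = m \<and> (\<forall>j. Polynomial.degree (q $ j) < m) \<and>
      (\<forall>f \<in> walsh_polys b I.
        \<bar>(1 / real (b ^ m)) * (\<Sum>n<b ^ m. (cmod (f (lattice_point p q n)))\<^sup>2)
          - (LINT x:Omega|lborel. (cmod (f x))\<^sup>2)\<bar>
        \<le> \<eta> * (LINT x:Omega|lborel. (cmod (f x))\<^sup>2)))"
proof -
  have b2: "2 \<le> b" unfolding assms(1) using prime_card prime_ge_2_nat by blast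
  \<comment> \<open>A crude bound: every entry of every index is below \<open>s\<close>, and
    \<open>s < b ^ s\<close>. The successor also keeps \<open>s\<close> positive when all entries
    are 0.\<close>
  define s where "s = Suc (\<Sum>h\<in>I. \<Sum>j\<in>UNIV. h $ j)"
  have I: "\<forall>h\<in>I. \<forall>j. h $ j < b ^ s"
  proof (intro ballI allI)
    fix h :: "nat ^ 'd" and j assume "h \<in> I"
    then have "(\<Sum>j\<in>UNIV. h $ j) \<le> (\<Sum>h\<in>I. \<Sum>j\<in>UNIV. h $ j)"
      using assms(2) by (intro member_le_sum) auto
    moreover have "h $ j \<le> (\<Sum>j\<in>UNIV. h $ j)" by (intro member_le_sum) auto
    moreover have "s < b ^ s" using b2 by (simp add: power_gt_expt)
    ultimately show "h $ j < b ^ s" by (simp add: s_def)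
  qed
  obtain idx :: "'d \<Rightarrow> nat" where idx: "bij_betw idx UNIV {..<CARD('d)}"
    using ex_bij_betw_finite_nat[of "UNIV :: 'd set"] by (auto simp: atLeast0LessThan)
  show ?thesis
  \<comment> \<open>From this threshold on, \<open>n\<close> has room for \<open>CARD('d)\<close>
    disjoint blocks of \<open>s\<close> digits.\<close>
  proof (intro exI[of _ "s * CARD('d)"] conjI allI impI)
    show "s * CARD('d) > 0" by (simp add: s_def)
  next
    fix m assume m: "s * CARD('d) \<le> m"
    let ?p = "Polynomial.monom 1 m :: 'p mod_ring poly"
    let ?q = "(\<chi> j. Polynomial.monom 1 (s * (CARD('d) - 1 - idx j))) :: 'p mod_ring poly ^ 'd"
    have "s * (CARD('d) - 1 - idx j) < m" for j
      by (rule less_le_trans[OF mult_less_mono2 m]) (simp_all add: s_def)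
    then have deg: "\<forall>j. Polynomial.degree (?q $ j) < m" by (simp add: degree_monom_eq)
    have exact: "(1 / real (b ^ m)) * (\<Sum>n<b ^ m. (cmod (f (lattice_point ?p ?q n)))\<^sup>2)
        = (LINT x:Omega|lborel. (cmod (f x))\<^sup>2)" if f: "f \<in> walsh_polys b I" for f
      using lattice_sum_const_on_cells[where ?'p = 'p, OF _ idx m, of "\<lambda>x. (cmod (f x))\<^sup>2"]
        walsh_polys_const_on_cells[OF b2 f I]
      by (simp add: assms(1))
    \<comment> \<open>The quadrature error is exactly zero, so the required estimate reduces to its
      right-hand side being nonnegative.\<close>
    have nonneg: "0 \<le> \<eta> * (LINT x:Omega|lborel. (cmod (f x))\<^sup>2)" for f :: "real ^ 'd \<Rightarrow> complex"
      unfolding set_lebesgue_integral_def using assms(5)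
      by (intro mult_nonneg_nonneg Bochner_Integration.integral_nonneg) auto
    show "\<exists>(p :: 'p mod_ring poly) (q :: 'p mod_ring poly ^ 'd).
      Polynomial.degree p = m \<and> (\<forall>j. Polynomial.degree (q $ j) < m) \<and>
      (\<forall>f \<in> walsh_polys b I.
        \<bar>(1 / real (b ^ m)) * (\<Sum>n<b ^ m. (cmod (f (lattice_point p q n)))\<^sup>2)
          - (LINT x:Omega|lborel. (cmod (f x))\<^sup>2)\<bar>
        \<le> \<eta> * (LINT x:Omega|lborel. (cmod (f x))\<^sup>2))"
      by (rule exI[of _ ?p], rule exI[of _ ?q]) (use deg exact nonneg in \<open>simp add: degree_monom_eq\<close>)
  qed
qed

end
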